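(* Let $q\in[1,+\infty]$ and suppose $\bigl\|\,\|Q^*(X)\|\,\bigr\|_{L^q}<+\infty$. Suppose further that the following assumptions hold. (1) For each $z\in\mathcal Z$, $|c(z,\bar y)-c(z,y)|\le L(z)\|\bar y-y\|$ for all $y,\bar y\in\mathcal Y$, where $\sup_{z\in\mathcal Z}L(z)<+\infty$. (2) $\bigl\|\sup_{z\in\mathcal Z}|g_n^*(z;X)-g(z;X)|\bigr\|_{L^q}\xrightarrow{p}0$. (3) $\frac1n\sum_{i=1}^n\|Q^*(x^i)\|^4\xrightarrow{p}\mathbb E[\|Q^*(X)\|^4]$ and $\frac1n\sum_{i=1}^n\|[Q^*(x^i)]^{-1}\|^2\xrightarrow{p}\mathbb E[\|[Q^*(X)]^{-1}\|^2]$ (these expectations being finite). (4) $\frac1n\sum_{i=1}^n\|\varepsilon^i\|^4\xrightarrow{p}\mathbb E[\|\varepsilon\|^4]$ (this expectation being finite). (5) The regression estimates satisfy: (a) $\|\hat f_n(X)-f^*(X)\|_{L^q}\xrightarrow{p}0$; (b) $\frac1n\sum_{i=1}^n\|f^*(x^i)-\hat f_n(x^i)\|^2\xrightarrow{p}0$; (c) $\|\hat Q_n(X)-Q^*(X)\|_{L^q}\xrightarrow{p}0$; (d) $\frac1n\sum_{i=1}^n\|[\hat Q_n(x^i)]^{-1}-[Q^*(x^i)]^{-1}\|^2\xrightarrow{p}0$. Then $$\|\hat v_n^{ER}(X)-v^*(X)\|_{L^q}\xrightarrow{p}0\qquad\text{and}\qquad \|g(\hat z_n^{ER}(X);X)-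v^*(X)\|_{L^q}\xrightarrow{p}0.$$
   Context: Setting. $X$ is a random vector of covariates with distribution $P_X$ and support $\mathcal X\subseteq\mathbb R^{d_x}$; $Y$ is a random vector with (closed) support $\mathcal Y\subseteq\mathbb R^{d_y}$, which is assumed nonempty and convex. $\mathcal Z\subset\mathbb R^{d_z}$ is nonempty and compact and $c:\mathcal Z\times\mathcal Y\to\mathbb R$. It is assumed that $Y=f^*(X)+Q^*(X)\varepsilon$, where $f^*(x)=\mathbb E[Y\mid X=x]$, $Q^*(\bar x)\in\mathbb R^{d_y\times d_y}$ is positive definite for all $\bar x\in\mathcal X$, and $\varepsilon$ is a zero-mean random vector independent of $X$ with distribution $P_\varepsilon$ and support $\Xi\subseteq\mathbb R^{d_y}$. True problem: $v^*(x):=\min_{z\in\mathcal Z}\{g(z;x):=\mathbb E[c(z,f^*(x)+Q^*(x)\varepsilon)]\}$ (expectation over $\varepsilon\sim P_\varepsilon$). It is assumed that $\mathbb E[|c(z,f^*(x)+Q^*(x)\varepsilon)|]<+\infty$ for each $z\in\mathcal Z$ and a.e. $x\in\mathcal X$, and that $g(\cdot;x)$ is lower semicontinuous on $\mathcal Z$ for a.e. $x\in\mathcal X$. Data: $\mathcal D_n=\{(y^i,x^i)\}_{i=1}^n$ are joint observations of $(Y,X)$ (not assumed i.i.d. unless stated), and $\varepsilon^i:=[Q^*(x^i)]^{-1}(y^i-f^*(x^i))$ are the corresponding error realizations. Full-information SAA objective: $g_n^*(z;x):=\frac1n\sum_{i=1}^n c(z,f^*(x)+Q^*(x)\varepsilon^i)$;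 for a.e. $x$, the points $f^*(x)+Q^*(x)\varepsilon^i$ lie in $\mathcal Y$ almost surely. Estimates: $\hat f_n:\mathcal X\to\mathbb R^{d_y}$ and $\hat Q_n:\mathcal X\to\mathbb R^{d_y\times d_y}$ (with $\hat Q_n(\bar x)$ nonsingular for all $\bar x\in\mathcal X$) are estimates of $f^*$ and $Q^*$ computed from $\mathcal D_n$. Empirical residuals: $\hat\varepsilon_n^i:=[\hat Q_n(x^i)]^{-1}(y^i-\hat f_n(x^i))$. With $\operatorname{proj}_{\mathcal Y}$ the orthogonal projection onto $\mathcal Y$, the empirical-residuals SAA (ER-SAA) problem is $$\hat v_n^{ER}(x):=\min_{z\in\mathcal Z}\Bigl\{\hat g_n^{ER}(z;x):=\frac1n\sum_{i=1}^n c\bigl(z,\operatorname{proj}_{\mathcal Y}(\hat f_n(x)+\hat Q_n(x)\hat\varepsilon_n^i)\bigr)\Bigr\}.$$ Its optimal solution set is assumed nonempty for a.e. $x\in\mathcal X$, and $\hat z_n^{ER}(x)$ denotes an optimal solution. Conventions: $\|\cdot\|$ is the Euclidean norm or its induced matrix norm; "a.e. $x\in\mathcal X$" is with respect to $P_X$; probabilities and $\xrightarrow{p}$ (convergence in probability as $n\to\infty$) refer to the measure generating the data; all functions, sets and selections are assumed measurable. For $q\in[1,+\infty]$ and a measurable function $F$ on $\mathcal X$ (vector- or matrix-valued), $\|F\|_{L^q}=\|F(X)\|_{L^q}:=\bigl(\int_{\mathcal X}\|F(x)\|^q\,dP_X(x)\bigr)^{1/q}$ (the $P_X$-essential supremum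 of $\|F\|$ if $q=+\infty$); when $F$ depends on the data $\mathcal D_n$, the integral is over $x$ only, with the data held fixed, so the norm is a random variable. *)

theory Defs
  imports "HOL-Probability.Probability"
begin

definition msupport :: "'a::topological_space measure \<Rightarrow> 'a set" where
  "msupport \<mu> = {x. \<forall>U. open U \<and> x \<in> U \<longrightarrow> emeasure \<mu> U > 0}"

text \<open>The norm \<open>norm\<close> on \<^typ>\<open>real^'n^'m\<close> is the Frobenius norm; the matrix norm
  induced by the Euclidean norm is the operator norm.\<close>

definition mat_norm :: "real^'n^'m \<Rightarrow> real" where
  "mat_norm A = onorm ((*v) A)"

definition pos_def :: "real^'n^'n \<Rightarrow> bool" where
  "pos_def A \<longleftrightarrow> transpose A = A \<and> (\<forall>v. v \<noteq> 0 \<longrightarrow> v \<bullet> (A *v v) > 0)"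

definition lsc_on :: "'a::topological_space set \<Rightarrow> ('a \<Rightarrow> real) \<Rightarrow> bool" where
  "lsc_on A h \<longleftrightarrow> (\<forall>z\<in>A. \<forall>t < h z. \<forall>\<^sub>F w in at z within A. t < h w)"

text \<open>\<open>f\<close> is a version of the conditional mean of \<open>Y\<close> given \<open>X\<close>. Conditional expectations in
  the library are real-valued, so the condition is imposed componentwise. Finiteness of the
  conditional expectation of the absolute value rules out the default value that
  \<^const>\<open>real_cond_exp\<close> takes otherwise.\<close>

definition is_cond_mean ::
  "'s measure \<Rightarrow> ('s \<Rightarrow> real^'m) \<Rightarrow> ('s \<Rightarrow> real^'k) \<Rightarrow> (real^'k \<Rightarrow> real^'m) \<Rightarrow> bool" where
  "is_cond_mean S Y X f \<longleftrightarrow>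
     (\<forall>j. AE s in S.
        nn_cond_exp S (vimage_algebra (space S) X borel) (\<lambda>s. ennreal \<bar>Y s $ j\<bar>) s < \<infinity> \<and>
        real_cond_exp S (vimage_algebra (space S) X borel) (\<lambda>s. Y s $ j) s = f (X s) $ j)"

text \<open>The library's \<open>indep_var\<close> requires both random variables to have the same type.\<close>

definition indep_rv ::
  "'s measure \<Rightarrow> ('s \<Rightarrow> 'a::topological_space) \<Rightarrow> ('s \<Rightarrow> 'b::topological_space) \<Rightarrow> bool" where
  "indep_rv S U V \<longleftrightarrow>
     prob_space.indep_set S (sets (vimage_algebra (space S) U borel))
                            (sets (vimage_algebra (space S) V borel))"

text \<open>The law of \<open>X\<close> as a measure on its support, so that \<open>AE x in law_on_support S X\<close> and
  measurability with respect to it concern only points of the support.\<close>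

definition law_on_support ::
  "'s measure \<Rightarrow> ('s \<Rightarrow> 'a::topological_space) \<Rightarrow> 'a measure" where
  "law_on_support S X = restrict_space (distr S borel X) (msupport (distr S borel X))"

definition epowr :: "ennreal \<Rightarrow> real \<Rightarrow> ennreal" where
  "epowr t r = (if t = \<infinity> then \<infinity> else ennreal (enn2real t powr r))"

text \<open>The extended \<open>L\<^sup>q\<close> norm, applied to the pointwise norm \<open>F\<close> of a function; the value may
  be infinite.\<close>

definition Lq_norm :: "ennreal \<Rightarrow> 'a measure \<Rightarrow> ('a \<Rightarrow> ennreal) \<Rightarrow> ennreal" where
  "Lq_norm q \<mu> F =
     (if q = \<infinity> then esssup \<mu> F
      else epowr (\<integral>\<^sup>+x. epowr (F x) (enn2real q) \<partial>\<mu>) (1 / enn2real q))"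

text \<open>Measurability is part of the definition, because the library assigns measure zero to
  non-measurable sets. Sequences start at index 1.\<close>

definition conv_prob_zero :: "'w measure \<Rightarrow> (nat \<Rightarrow> 'w \<Rightarrow> ennreal) \<Rightarrow> bool" where
  "conv_prob_zero M W \<longleftrightarrow>
     (\<forall>n\<ge>1. W n \<in> borel_measurable M) \<and>
     (\<forall>\<delta>>0. (\<lambda>n. measure M {\<omega> \<in> space M. W n \<omega> > ennreal \<delta>}) \<longlonglongrightarrow> 0)"

definition conv_prob :: "'w measure \<Rightarrow> (nat \<Rightarrow> 'w \<Rightarrow> real) \<Rightarrow> real \<Rightarrow> bool" where
  "conv_prob M W l \<longleftrightarrow>
     (\<forall>n\<ge>1. W n \<in> borel_measurable M) \<and>
     (\<forall>\<delta>>0. (\<lambda>n. measure M {\<omega> \<in> space M. \<bar>W n \<omega> - l\<bar> > \<delta>}) \<longlonglongrightarrow> 0)"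

end

theory Submission
  imports Defs
begin

text \<open>For almost every covariate \<open>x\<close>, everything is controlled by the uniform error
  \<open>u(x) = sup\<^sub>z \<bar>ghat\<^sub>n(z; x) - g(z; x)\<bar>\<close> of the approximate objective: the two optimal values differ by
  at most \<open>u(x)\<close>, and an optimal solution of the approximate problem is \<open>2 u(x)\<close>-optimal for the true
  one (\<open>optimal_value_perturbation\<close>). Going through the full-information objective, \<open>u(x)\<close> is at most
  the error of that objective, which tends to zero by hypothesis, plus
  \<open>sup\<^sub>z \<bar>ghat\<^sub>n(z; x) - gn\<^sub>n(z; x)\<bar>\<close>. Both of these averages run over the same data, and their scenarios
  \<open>fhat(x) + Qhat(x) res\<^sub>i\<close> and \<open>fstar(x) + Qstar(x) err\<^sub>i\<close> can be compared one by one. The latter already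
  lie in \<open>\<Y>\<close> and the projection onto \<open>\<Y>\<close> is nonexpansive, so that the Lipschitz property of the cost
  gives (\<open>mean_projected_cost_diff_le\<close>) the bound
  \<open>\<Lambda> (\<parallel>fhat(x) - fstar(x)\<parallel> + \<parallel>Qhat(x) - Qstar(x)\<parallel> (E\<^sub>n + R\<^sub>n) + \<parallel>Qstar(x)\<parallel> R\<^sub>n)\<close>,
  where \<open>E\<^sub>n\<close> is the mean norm of the errors and \<open>R\<^sub>n\<close> the mean distance between residuals and errors. The point of this bound is that each summand separates: one factor is a
  function of \<open>x\<close> whose norm in \<open>L\<^sup>q\<close> tends to zero or is constant, the other does not depend on \<open>x\<close>
  and, where that norm is only constant, tends to zero.

  By \<open>mean_residual_error_le\<close>, which is the Cauchy--Schwarz inequality for means,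
  \<open>R\<^sub>n\<close> tends to zero in probability: every term is the root of a mean that tends to zero times the root
  of a mean that converges. The fourth moments enter through
  \<open>\<parallel>Qstar\<parallel>\<^sup>2 \<parallel>err\<parallel>\<^sup>2 \<le> \<parallel>Qstar\<parallel>\<^sup>4 + \<parallel>err\<parallel>\<^sup>4\<close>, and they bound \<open>E\<^sub>n\<close>
  because \<open>t \<le> 1 + t\<^sup>4\<close> for \<open>t \<ge> 0\<close>.

  Two devices keep the passage to the limit short. Convergence in probability is convergence along a
  filter on pairs of a sample size and an outcome, so the rules for limits of sums, products and
  roots apply as they stand. And in \<open>L\<^sup>q\<close> the triangle inequality is needed only up to a constant
  factor (\<open>Lq_norm_add_le\<close>), which has a proof by elementary estimates of powers, uniform in \<open>q\<close>.\<close>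

section \<open>The operator norm of matrices and measurability\<close>

lemma norm_matrix_vector_le: "norm (A *v v) \<le> mat_norm A * norm v"
  unfolding mat_norm_def by (rule onorm) simp

lemma mat_norm_nonneg [simp]: "0 \<le> mat_norm A"
  unfolding mat_norm_def by (rule onorm_pos_le) simp

lemma mat_norm_add_le: "mat_norm (A + B) \<le> mat_norm A + mat_norm B"
proof -
  have "(*v) (A + B) = (\<lambda>v. A *v v + B *v v)"
    by (simp add: fun_eq_iff matrix_vector_mult_add_rdistrib)
  then show ?thesis
    unfolding mat_norm_def by (simp add: onorm_triangle)
qed

lemma mat_norm_le_norm:
  fixes A :: "real^'n^'m"
  shows "mat_norm A \<le> real CARD('m) * real CARD('n) * norm A"
proof -
  have "\<bar>A $ i $ j\<bar> \<le> norm A" for i j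
    using component_le_norm_cart[of "A $ i" j] Finite_Cartesian_Product.norm_nth_le[of A i] by (simp add: order_trans)
  then show ?thesis
    unfolding mat_norm_def by (rule onorm_le_matrix_component)
qed

text \<open>The operator norm is dominated by a multiple of the Frobenius norm, which defines the topology of the matrix
  space; hence it is Lipschitz continuous.\<close>

lemma mat_norm_borel [measurable]: "(mat_norm :: real^'n^'m \<Rightarrow> real) \<in> borel_measurable borel"
proof -
  define K where "K = real CARD('m) * real CARD('n)"
  have le: "mat_norm A \<le> mat_norm B + K * dist A B" for A B :: "real^'n^'m"
    using mat_norm_add_le[of B "A - B"] mat_norm_le_norm[of "A - B"]
    by (simp add: K_def dist_norm)
  have "K-lipschitz_on UNIV (mat_norm :: real^'n^'m \<Rightarrow> real)"
  proof (rule lipschitz_onI)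
    show "0 \<le> K" by (simp add: K_def)
    show "dist (mat_norm A) (mat_norm B) \<le> K * dist A B" for A B :: "real^'n^'m"
      using le[of A B] le[of B A] by (simp add: dist_real_def dist_commute abs_le_iff)
  qed
  then show ?thesis
    by (intro borel_measurable_continuous_onI lipschitz_on_continuous_on)
qed

lemma borel_measurable_matrix_vector_mult [measurable]:
  fixes A :: "'a \<Rightarrow> real^'n^'m"
  assumes "A \<in> borel_measurable N" "v \<in> borel_measurable N"
  shows "(\<lambda>x. A x *v v x) \<in> borel_measurable N"
proof -
  have "bilinear ((*v) :: real^'n^'m \<Rightarrow> _)"
    unfolding bilinear_def
    by (auto intro!: linearI simp: matrix_vector_mult_add_rdistrib scaleR_matrix_vector_assoc[symmetric])
  then have bb: "bounded_bilinear ((*v) :: real^'n^'m \<Rightarrow> _)"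
    by (simp add: bilinear_conv_bounded_bilinear)
  show ?thesis
    using assms
    by (rule borel_measurable_continuous_Pair)
       (rule bounded_bilinear.continuous_on[OF bb]; intro continuous_intros)
qed

lemma borel_measurable_vec_nth:
  fixes f :: "'a \<Rightarrow> 'b::euclidean_space^'n"
  assumes "f \<in> borel_measurable N"
  shows "(\<lambda>x. f x $ i) \<in> borel_measurable N"
  using assms
  by (rule measurable_compose) (intro borel_measurable_continuous_onI continuous_intros)

lemma invertible_pos_def: "pos_def A \<Longrightarrow> invertible A"
  unfolding invertible_left_inverse matrix_left_invertible_ker pos_def_def
  by (metis inner_zero_right less_irrefl)

lemma matrix_vector_matrix_inv:
  fixes A :: "real^'n^'n"
  assumes "invertible A"
  shows "A *v (matrix_inv A *v b) = b"
proof -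
  have "A ** matrix_inv A = mat 1"
    using assms unfolding invertible_def matrix_inv_def by (rule someI2_ex) blast
  then show ?thesis
    by (metis matrix_vector_mul_assoc matrix_vector_mul_lid)
qed

text \<open>Cramer's rule exhibits the solution of a linear system as a rational function of the
  entries, hence as a measurable one.\<close>

lemma borel_measurable_matrix_inv_mult:
  fixes A :: "'a \<Rightarrow> real^'n^'n"
  assumes A: "A \<in> borel_measurable N" and b: "b \<in> borel_measurable N"
    and inv: "\<And>x. x \<in> space N \<Longrightarrow> invertible (A x)"
  shows "(\<lambda>x. matrix_inv (A x) *v b x) \<in> borel_measurable N"
proof -
  define u where "u = (\<lambda>x. (\<chi> k. det (\<chi> i j. if j = k then b x $ i else A x $ i $ j) / det (A x)))"
  have [measurable]: "(\<lambda>x. A x $ i $ j) \<in> borel_measurable N" "(\<lambda>x. b x $ i) \<in> borel_measurable N" for i j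
    using A b by (auto intro!: borel_measurable_vec_nth)
  have [measurable]: "(\<lambda>x. if j = k then b x $ i else A x $ i $ j) \<in> borel_measurable N" for i j k
    by (cases "j = k") auto
  have "(\<lambda>x. u x $ k) \<in> borel_measurable N" for k
    unfolding u_def det_def by simp
  then have "u \<in> borel_measurable N"
    by (auto simp: borel_measurable_euclidean_space[where f = u] Basis_vec_def inner_axis)
  moreover have "matrix_inv (A x) *v b x = u x" if "x \<in> space N" for x
  proof -
    have "det (A x) \<noteq> 0"
      using inv[OF that] by (simp add: invertible_det_nz)
    from cramer[OF this] matrix_vector_matrix_inv[OF inv[OF that]] show ?thesis
      by (simp add: u_def)
  qed
  ultimately show ?thesis
    by (simp cong: measurable_cong)
qed

text \<open>The complement of the support is the union of all open null sets.\<close>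

lemma closed_msupport: "closed (msupport \<mu>)"
proof -
  have "- msupport \<mu> = \<Union> {U. open U \<and> emeasure \<mu> U = 0}"
    by (auto simp: msupport_def not_gr_zero)
  then show ?thesis
    unfolding closed_def by (simp only:) (rule open_Union, simp)
qed

section \<open>The extended norms of L^q\<close>

lemma epowr_top [simp]: "epowr \<top> r = \<top>"
  and epowr_ennreal [simp]: "0 \<le> t \<Longrightarrow> epowr (ennreal t) r = ennreal (t powr r)"
  by (auto simp: epowr_def)

lemma epowr_mono: "0 \<le> r \<Longrightarrow> s \<le> t \<Longrightarrow> epowr s r \<le> epowr t r"
  by (cases s; cases t) (auto simp: epowr_def top_unique intro!: ennreal_leI powr_mono2)

lemma epowr_mult:
  assumes "0 < r"
  shows "epowr (s * t) r = epowr s r * epowr t r"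
proof -
  have 0: "epowr 0 r = 0"
    using epowr_ennreal[of 0 r] assms by simp
  then have *: "epowr (ennreal a * \<top>) r = epowr (ennreal a) r * \<top>" if "0 \<le> a" for a
    using that assms by (cases "a = 0") (auto simp: ennreal_mult_top)
  show ?thesis
  proof (cases s; cases t)
    fix a b assume "0 \<le> a" "s = ennreal a" "0 \<le> b" "t = ennreal b"
    then show ?thesis
      by (simp add: powr_mult ennreal_mult[symmetric])
  next
    fix a assume "0 \<le> a" "s = ennreal a" "t = \<top>"
    then show ?thesis using * by simp
  next
    fix a assume "0 \<le> a" "t = ennreal a" "s = \<top>"
    then show ?thesis using * by (simp only: mult.commute[of \<top>] epowr_top)
  qed (simp add: ennreal_mult_eq_top_iff)
qed

lemma epowr_epowr: "r \<noteq> 0 \<Longrightarrow> epowr (epowr t r) (1 / r) = t"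
  by (cases t) (auto simp: powr_powr)

text \<open>The larger summand \<open>t\<close> satisfies \<open>s + t \<le> 2 t\<close>; this covers exponents on both sides of \<open>1\<close>.\<close>

lemma epowr_add_le:
  assumes "0 \<le> r"
  shows "epowr (s + t) r \<le> ennreal (2 powr r) * (epowr s r + epowr t r)"
proof -
  have *: "epowr (s + t) r \<le> ennreal (2 powr r) * epowr t r" if "s \<le> t" for s t
    using that assms
    by (cases s; cases t)
       (auto simp: epowr_def top_unique ennreal_mult_top ennreal_mult[symmetric] powr_mult[symmetric] ennreal_plus[symmetric]
          simp del: ennreal_plus intro!: ennreal_leI powr_mono2)
  show ?thesis
  proof (cases "s \<le> t")
    case True
    show ?thesis
      using *[OF True] by (rule order_trans) (auto intro!: mult_left_mono)
  next
    case False
    then have "t \<le> s" by simp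
    from *[OF this] show ?thesis
      unfolding add.commute[of s] by (rule order_trans) (auto intro!: mult_left_mono)
  qed
qed

lemma borel_measurable_epowr [measurable]:
  "f \<in> borel_measurable N \<Longrightarrow> (\<lambda>x. epowr (f x) r) \<in> borel_measurable N"
  unfolding epowr_def by (intro measurable_If) auto

lemma enn2real_ge_1: "1 \<le> q \<Longrightarrow> q \<noteq> \<infinity> \<Longrightarrow> 1 \<le> enn2real q"
  by (cases q) auto

lemma Lq_norm_mono:
  assumes "F \<in> borel_measurable \<mu>" "AE x in \<mu>. F x \<le> G x"
  shows "Lq_norm q \<mu> F \<le> Lq_norm q \<mu> G"
  using assms unfolding Lq_norm_def
  by (auto intro!: esssup_AE_mono epowr_mono nn_integral_mono_AE elim!: eventually_mono)

lemma Lq_norm_cmult: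
  assumes F [measurable]: "F \<in> borel_measurable \<mu>" and q: "1 \<le> q"
  shows "Lq_norm q \<mu> (\<lambda>x. a * F x) \<le> a * Lq_norm q \<mu> F"
proof (cases "q = \<infinity>")
  case True
  have "AE x in \<mu>. a * F x \<le> a * esssup \<mu> F"
    using esssup_AE[of F \<mu>] by eventually_elim (auto intro: mult_left_mono)
  then have "esssup \<mu> (\<lambda>x. a * F x) \<le> a * esssup \<mu> F"
    by (intro esssup_I) auto
  with True show ?thesis
    by (simp add: Lq_norm_def)
next
  case False
  note q1 = enn2real_ge_1[OF q False]
  then have "Lq_norm q \<mu> (\<lambda>x. a * F x) = a * Lq_norm q \<mu> F"
    using False by (simp only: Lq_norm_def if_False) (simp add: epowr_mult nn_integral_cmult epowr_epowr)
  then show ?thesis by simp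
qed

text \<open>A triangle inequality up to a constant factor suffices to pass to limits. For finite \<open>q\<close> it
  follows from \<open>(s + t)\<^sup>r \<le> 2\<^sup>r (s\<^sup>r + t\<^sup>r)\<close>, used inside the integral with \<open>r = q\<close>, which costs a factor
  \<open>2\<close> after taking the root, and for the outer power with \<open>r = 1/q\<close>, which costs \<open>2 powr (1/q) \<le> 2\<close>.\<close>

lemma Lq_norm_add_le:
  assumes [measurable]: "F \<in> borel_measurable \<mu>" "G \<in> borel_measurable \<mu>" and q: "1 \<le> q"
  shows "Lq_norm q \<mu> (\<lambda>x. F x + G x) \<le> 4 * (Lq_norm q \<mu> F + Lq_norm q \<mu> G)"
proof (cases "q = \<infinity>")
  case True
  have "AE x in \<mu>. F x + G x \<le> esssup \<mu> F + esssup \<mu> G"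
    using esssup_AE[of F \<mu>] esssup_AE[of G \<mu>] by eventually_elim (rule add_mono)
  then have "esssup \<mu> (\<lambda>x. F x + G x) \<le> 1 * (esssup \<mu> F + esssup \<mu> G)"
    by (auto intro!: esssup_I)
  also have "\<dots> \<le> 4 * (esssup \<mu> F + esssup \<mu> G)"
    by (intro mult_right_mono) auto
  finally show ?thesis using True by (simp add: Lq_norm_def)
next
  case False
  define r where "r = enn2real q"
  have r: "1 \<le> r"
    using enn2real_ge_1[OF q False] by (simp add: r_def)
  define I J where "I = (\<integral>\<^sup>+x. epowr (F x) r \<partial>\<mu>)" and "J = (\<integral>\<^sup>+x. epowr (G x) r \<partial>\<mu>)"
  have "(\<integral>\<^sup>+x. epowr (F x + G x) r \<partial>\<mu>) \<le> (\<integral>\<^sup>+x. ennreal (2 powr r) * (epowr (F x) r + epowr (G x) r) \<partial>\<mu>)"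
    using r by (intro nn_integral_mono epowr_add_le) auto
  also have "\<dots> = ennreal (2 powr r) * (I + J)"
    by (simp add: nn_integral_cmult nn_integral_add I_def J_def)
  finally have "epowr (\<integral>\<^sup>+x. epowr (F x + G x) r \<partial>\<mu>) (1 / r) \<le> epowr (ennreal (2 powr r) * (I + J)) (1 / r)"
    using r by (intro epowr_mono) auto
  also have "\<dots> = 2 * epowr (I + J) (1 / r)"
    using r by (simp add: epowr_mult powr_powr)
  also have "\<dots> \<le> 2 * (ennreal (2 powr (1 / r)) * (epowr I (1 / r) + epowr J (1 / r)))"
    using r by (intro mult_left_mono epowr_add_le) auto
  also have "\<dots> \<le> 2 * (2 * (epowr I (1 / r) + epowr J (1 / r)))"
  proof (intro mult_left_mono mult_right_mono)
    have "2 powr (1 / r) \<le> 2 powr (1::real)"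
      using r by (intro powr_mono) auto
    then show "ennreal (2 powr (1 / r)) \<le> 2"
      by (metis ennreal_leI ennreal_numeral powr_one zero_le_numeral)
  qed auto
  finally show ?thesis
    using False by (simp only: Lq_norm_def r_def I_def J_def mult.assoc[symmetric]) simp
qed

text \<open>The bound on the optimality gap is a combination of four functions of the covariate. Three
  applications of the weak triangle inequality give the factor \<open>4\<^sup>3 = 64\<close>.\<close>

lemma Lq_norm_combination4_le:
  assumes F: "F1 \<in> borel_measurable \<mu>" "F2 \<in> borel_measurable \<mu>" "F3 \<in> borel_measurable \<mu>"
      "F4 \<in> borel_measurable \<mu>"
    and q: "1 \<le> q"
  shows "Lq_norm q \<mu> (\<lambda>x. a1 * F1 x + (a2 * F2 x + (a3 * F3 x + a4 * F4 x)))
    \<le> 64 * (a1 * Lq_norm q \<mu> F1 + a2 * Lq_norm q \<mu> F2 + a3 * Lq_norm q \<mu> F3 + a4 * Lq_norm q \<mu> F4)"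
proof -
  note [measurable] = F
  let ?N = "Lq_norm q \<mu>"
  have weaken: "s \<le> 4 * t" if "s \<le> t" for s t :: ennreal
    using mult_mono[of 1 4 s t] that by simp
  have step: "?N (\<lambda>x. a * F x + K x) \<le> 4 * (a * ?N F + k)"
    if "F \<in> borel_measurable \<mu>" "K \<in> borel_measurable \<mu>" "?N K \<le> k" for a F K k
  proof -
    have "?N (\<lambda>x. a * F x + K x) \<le> 4 * (?N (\<lambda>x. a * F x) + ?N K)"
      using that q by (intro Lq_norm_add_le) auto
    also have "\<dots> \<le> 4 * (a * ?N F + k)"
      using that q by (intro mult_left_mono add_mono Lq_norm_cmult) auto
    finally show ?thesis .
  qed
  have "?N (\<lambda>x. a1 * F1 x + (a2 * F2 x + (a3 * F3 x + a4 * F4 x)))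
      \<le> 4 * (a1 * ?N F1 + 4 * (a2 * ?N F2 + 4 * (a3 * ?N F3 + a4 * ?N F4)))"
    by (intro step Lq_norm_cmult F q) measurable
  also have "\<dots> \<le> 4 * (4 * (4 * (a1 * ?N F1)) + 4 * (4 * (a2 * ?N F2) + 4 * (a3 * ?N F3 + a4 * ?N F4)))"
    by (intro mult_left_mono add_mono weaken order_refl) auto
  also have "\<dots> = 64 * (a1 * ?N F1 + a2 * ?N F2 + a3 * ?N F3 + a4 * ?N F4)"
    by (simp add: distrib_left mult.assoc[symmetric] add.assoc)
  finally show ?thesis .
qed

text \<open>For the essential supremum, \<open>esssup (F \<omega>) \<le> y\<close> says that the section \<open>{x. F \<omega> x > y}\<close> is a null
  set, and the measure of a section depends measurably on \<open>\<omega>\<close>.\<close>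

lemma (in sigma_finite_measure) borel_measurable_Lq_norm:
  assumes [measurable]: "(\<lambda>(\<omega>, x). F \<omega> x) \<in> borel_measurable (N \<Otimes>\<^sub>M M)"
  shows "(\<lambda>\<omega>. Lq_norm q M (F \<omega>)) \<in> borel_measurable N"
proof (cases "q = \<infinity>")
  case True
  have "(\<lambda>\<omega>. esssup M (F \<omega>)) \<in> borel_measurable N"
  proof (rule borel_measurableI_le)
    fix y
    have iff: "esssup M (F \<omega>) \<le> y \<longleftrightarrow> (\<integral>\<^sup>+x. indicator {z. z > y} (F \<omega> x) \<partial>M) = 0"
      if \<omega> [measurable]: "\<omega> \<in> space N" for \<omega>
    proof -
      have [measurable]: "F \<omega> \<in> borel_measurable M"
        using measurable_compose[OF measurable_Pair1'[OF \<omega>] assms] by simp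
      have "(\<integral>\<^sup>+x. indicator {z. z > y} (F \<omega> x) \<partial>M) = 0 \<longleftrightarrow> (AE x in M. F \<omega> x \<le> y)"
        by (subst nn_integral_0_iff_AE) (auto simp: indicator_def not_less cong: AE_cong)
      also have "\<dots> \<longleftrightarrow> esssup M (F \<omega>) \<le> y"
        using esssup_AE[of "F \<omega>" M] by (auto intro!: esssup_I elim!: eventually_mono)
      finally show ?thesis by simp
    qed
    have "(\<lambda>\<omega>. \<integral>\<^sup>+x. indicator {z. z > y} (F \<omega> x) \<partial>M) \<in> borel_measurable N"
      by measurable
    then have "{\<omega> \<in> space N. (\<integral>\<^sup>+x. indicator {z. z > y} (F \<omega> x) \<partial>M) = 0} \<in> sets N"
      by measurable
    also have "{\<omega> \<in> space N. (\<integral>\<^sup>+x. indicator {z. z > y} (F \<omega> x) \<partial>M) = 0}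
        = {\<omega> \<in> space N. esssup M (F \<omega>) \<le> y}"
      using iff by auto
    finally show "{\<omega> \<in> space N. esssup M (F \<omega>) \<le> y} \<in> sets N" .
  qed
  with True show ?thesis by (simp add: Lq_norm_def)
next
  case False
  then show ?thesis by (simp add: Lq_norm_def)
qed

section \<open>Convergence in probability as convergence along a filter\<close>

text \<open>A property holds eventually along this filter if, at each sample size \<open>n \<ge> 1\<close>, it can fail only on
  a null set and on an event whose probability vanishes as \<open>n\<close> grows. Properties need not be
  measurable. The null sets are allowed for because the assumptions on the data hold only almost
  surely; sample size \<open>0\<close> is left out because the estimates are constrained only from \<open>1\<close> on.\<close>

definition in_prob :: "'w measure \<Rightarrow> (nat \<times> 'w) filter" where
  "in_prob M = Abs_filter (\<lambda>P. \<exists>B. (\<forall>n\<ge>1. B n \<in> sets M) \<and> (\<lambda>n. measure M (B n)) \<longlonglongrightarrow> 0 \<and>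
     (\<forall>n\<ge>1. AE \<omega> in M. \<omega> \<notin> B n \<longrightarrow> P (n, \<omega>)))"

lemma (in finite_measure) eventually_in_prob:
  "eventually P (in_prob M) \<longleftrightarrow> (\<exists>B. (\<forall>n\<ge>1. B n \<in> sets M) \<and> (\<lambda>n. measure M (B n)) \<longlonglongrightarrow> 0 \<and>
     (\<forall>n\<ge>1. AE \<omega> in M. \<omega> \<notin> B n \<longrightarrow> P (n, \<omega>)))"
  unfolding in_prob_def
proof (rule eventually_Abs_filter, rule is_filter.intro, goal_cases)
  case 1
  show ?case by (intro exI[of _ "\<lambda>_. {}"]) simp
next
  case (2 P Q)
  then obtain B C where
    B: "\<forall>n\<ge>1. B n \<in> sets M" "(\<lambda>n. measure M (B n)) \<longlonglongrightarrow> 0" "\<forall>n\<ge>1. AE \<omega> in M. \<omega> \<notin> B n \<longrightarrow> P (n, \<omega>)"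
    and C: "\<forall>n\<ge>1. C n \<in> sets M" "(\<lambda>n. measure M (C n)) \<longlonglongrightarrow> 0" "\<forall>n\<ge>1. AE \<omega> in M. \<omega> \<notin> C n \<longrightarrow> Q (n, \<omega>)"
    by blast
  show ?case
  proof (intro exI[of _ "\<lambda>n. B n \<union> C n"] conjI allI impI)
    show "B n \<union> C n \<in> sets M" if "1 \<le> n" for n
      using B(1) C(1) that by auto
    show "AE \<omega> in M. \<omega> \<notin> B n \<union> C n \<longrightarrow> P (n, \<omega>) \<and> Q (n, \<omega>)" if "1 \<le> n" for n
      using B(3)[rule_format, OF that] C(3)[rule_format, OF that] by eventually_elim auto
    show "(\<lambda>n. measure M (B n \<union> C n)) \<longlonglongrightarrow> 0"
    proof (rule tendsto_sandwich)
      show "(\<lambda>_. 0::real) \<longlonglongrightarrow> 0" "\<forall>\<^sub>F n in sequentially. 0 \<le> measure M (B n \<union> C n)"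
        by simp_all
      show "(\<lambda>n. measure M (B n) + measure M (C n)) \<longlonglongrightarrow> 0"
        using tendsto_add[OF B(2) C(2)] by simp
      show "\<forall>\<^sub>F n in sequentially. measure M (B n \<union> C n) \<le> measure M (B n) + measure M (C n)"
        using eventually_ge_at_top[of 1] by eventually_elim (use B(1) C(1) in \<open>simp add: measure_Un_le\<close>)
    qed
  qed
next
  case (3 P Q)
  then obtain B where B: "\<forall>n\<ge>1. B n \<in> sets M" "(\<lambda>n. measure M (B n)) \<longlonglongrightarrow> 0"
    and "\<And>n. 1 \<le> n \<Longrightarrow> AE \<omega> in M. \<omega> \<notin> B n \<longrightarrow> P (n, \<omega>)"
    by blast
  then have "AE \<omega> in M. \<omega> \<notin> B n \<longrightarrow> Q (n, \<omega>)" if "1 \<le> n" for n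
    using 3(1) that by (fastforce elim: eventually_mono)
  with B show ?case by blast
qed

lemma (in finite_measure) eventually_in_prob_AE:
  "(\<And>n. 1 \<le> n \<Longrightarrow> AE \<omega> in M. P (n, \<omega>)) \<Longrightarrow> eventually P (in_prob M)"
  unfolding eventually_in_prob by (intro exI[of _ "\<lambda>_. {}"]) auto

text \<open>The threshold \<open>\<delta>\<close> of convergence in probability is finite, whereas neighbourhoods of \<open>0\<close> in the
  extended reals are given by arbitrary \<open>a > 0\<close>; density supplies a finite \<open>\<delta> < a\<close>.\<close>

lemma (in finite_measure) conv_prob_zero_iff:
  "conv_prob_zero M W \<longleftrightarrow>
    (\<forall>n\<ge>1. W n \<in> borel_measurable M) \<and> ((\<lambda>(n, \<omega>). W n \<omega>) \<longlongrightarrow> 0) (in_prob M)"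
proof (intro iffI conjI)
  assume W: "conv_prob_zero M W"
  then show meas: "\<forall>n\<ge>1. W n \<in> borel_measurable M"
    by (simp add: conv_prob_zero_def)
  show "((\<lambda>(n, \<omega>). W n \<omega>) \<longlongrightarrow> 0) (in_prob M)"
  proof (rule order_tendstoI)
    fix a :: ennreal assume "0 < a"
    then obtain d where d: "0 < d" "d < a" using dense by blast
    then have "d \<noteq> \<infinity>" by auto
    with d obtain \<delta> where \<delta>: "0 < \<delta>" "ennreal \<delta> < a"
      by (cases d) auto
    show "\<forall>\<^sub>F x in in_prob M. (case x of (n, \<omega>) \<Rightarrow> W n \<omega>) < a"
      unfolding eventually_in_prob
    proof (intro exI[of _ "\<lambda>n. {\<omega> \<in> space M. W n \<omega> > ennreal \<delta>}"] conjI allI impI)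
      show "{\<omega> \<in> space M. W n \<omega> > ennreal \<delta>} \<in> sets M" if "1 \<le> n" for n
        using meas[rule_format, OF that] by measurable
      show "(\<lambda>n. measure M {\<omega> \<in> space M. W n \<omega> > ennreal \<delta>}) \<longlonglongrightarrow> 0"
        using W \<delta> by (simp add: conv_prob_zero_def)
      show "AE \<omega> in M. \<omega> \<notin> {\<omega> \<in> space M. W n \<omega> > ennreal \<delta>} \<longrightarrow> (case (n, \<omega>) of (n, \<omega>) \<Rightarrow> W n \<omega>) < a" for n
        using \<delta> by (intro AE_I2) auto
    qed
  qed simp
next
  assume W: "(\<forall>n\<ge>1. W n \<in> borel_measurable M) \<and> ((\<lambda>(n, \<omega>). W n \<omega>) \<longlongrightarrow> 0) (in_prob M)"
  show "conv_prob_zero M W"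
    unfolding conv_prob_zero_def
  proof (intro conjI allI impI)
    fix \<delta> :: real assume "0 < \<delta>"
    then have "\<forall>\<^sub>F x in in_prob M. (case x of (n, \<omega>) \<Rightarrow> W n \<omega>) < ennreal \<delta>"
      using W by (intro order_tendstoD(2)) auto
    then obtain B where B: "\<forall>n\<ge>1. B n \<in> sets M" "(\<lambda>n. measure M (B n)) \<longlonglongrightarrow> 0"
      "\<forall>n\<ge>1. AE \<omega> in M. \<omega> \<notin> B n \<longrightarrow> W n \<omega> < ennreal \<delta>"
      unfolding eventually_in_prob by auto
    have "measure M {\<omega> \<in> space M. W n \<omega> > ennreal \<delta>} \<le> measure M (B n)" if "1 \<le> n" for n
      using B(3)[rule_format, OF that] B(1) that
      by (intro finite_measure_mono_AE) (auto elim!: eventually_mono)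
    then show "(\<lambda>n. measure M {\<omega> \<in> space M. W n \<omega> > ennreal \<delta>}) \<longlonglongrightarrow> 0"
      by (intro tendsto_sandwich[OF _ _ tendsto_const B(2)])
         (auto intro!: eventually_mono[OF eventually_ge_at_top[of 1]])
  qed (use W in auto)
qed

lemma (in finite_measure) conv_prob_tendsto:
  assumes W: "conv_prob M W l"
  shows "((\<lambda>(n, \<omega>). W n \<omega>) \<longlongrightarrow> l) (in_prob M)"
proof (rule tendstoI)
  fix e :: real assume "0 < e"
  show "\<forall>\<^sub>F x in in_prob M. dist (case x of (n, \<omega>) \<Rightarrow> W n \<omega>) l < e"
    unfolding eventually_in_prob
  proof (intro exI[of _ "\<lambda>n. {\<omega> \<in> space M. \<bar>W n \<omega> - l\<bar> > e / 2}"] conjI allI impI)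
    show "{\<omega> \<in> space M. \<bar>W n \<omega> - l\<bar> > e / 2} \<in> sets M" if "1 \<le> n" for n
    proof -
      have [measurable]: "W n \<in> borel_measurable M"
        using W that by (simp add: conv_prob_def)
      show ?thesis by measurable
    qed
    show "(\<lambda>n. measure M {\<omega> \<in> space M. \<bar>W n \<omega> - l\<bar> > e / 2}) \<longlonglongrightarrow> 0"
      using W half_gt_zero[OF \<open>0 < e\<close>] unfolding conv_prob_def by blast
    show "AE \<omega> in M. \<omega> \<notin> {\<omega> \<in> space M. \<bar>W n \<omega> - l\<bar> > e / 2} \<longrightarrow>
        dist (case (n, \<omega>) of (n, \<omega>) \<Rightarrow> W n \<omega>) l < e" for n
      using \<open>0 < e\<close> by (intro AE_I2) (auto simp: dist_real_def)
  qed
qed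

section \<open>Perturbation of residuals and of objectives\<close>

abbreviation (input) mean :: "nat \<Rightarrow> (nat \<Rightarrow> real) \<Rightarrow> real" where
  "mean n f \<equiv> (1 / real n) * (\<Sum>i=1..n. f i)"

lemma mean_mono: "(\<And>i. i \<in> {1..n} \<Longrightarrow> f i \<le> h i) \<Longrightarrow> mean n f \<le> mean n h"
  by (intro mult_left_mono sum_mono) auto

lemma mean_nonneg: "(\<And>i. i \<in> {1..n} \<Longrightarrow> 0 \<le> f i) \<Longrightarrow> 0 \<le> mean n f"
  by (intro mult_nonneg_nonneg sum_nonneg) auto

lemma mean_add: "mean n (\<lambda>i. f i + h i) = mean n f + mean n h"
  by (simp add: sum.distrib distrib_left)

lemma mean_cmult: "mean n (\<lambda>i. a * f i) = a * mean n f"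
  by (simp add: sum_distrib_left mult_ac)

lemma Cauchy_Schwarz_mean:
  "mean n (\<lambda>i. a i * b i) \<le> sqrt (mean n (\<lambda>i. a i ^ 2)) * sqrt (mean n (\<lambda>i. b i ^ 2))"
proof (rule power2_le_imp_le)
  have "(mean n (\<lambda>i. a i * b i))\<^sup>2 = (1 / real n)\<^sup>2 * (\<Sum>i=1..n. a i * b i)\<^sup>2"
    by (simp add: power_mult_distrib power_divide)
  also have "\<dots> \<le> (1 / real n)\<^sup>2 * ((\<Sum>i=1..n. (a i)\<^sup>2) * (\<Sum>i=1..n. (b i)\<^sup>2))"
    by (intro mult_left_mono Cauchy_Schwarz_ineq_sum) auto
  also have "\<dots> = (sqrt (mean n (\<lambda>i. a i ^ 2)) * sqrt (mean n (\<lambda>i. b i ^ 2)))\<^sup>2"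
    by (simp add: power_mult_distrib sum_nonneg) (simp add: power2_eq_square)
  finally show "(mean n (\<lambda>i. a i * b i))\<^sup>2 \<le> \<dots>" .
qed (simp add: sum_nonneg)

text \<open>Convergence of the fourth moments thus bounds the first ones in probability.\<close>

lemma mean_norm_le_mean_power4:
  assumes "1 \<le> n"
  shows "mean n (\<lambda>i. norm (e i)) \<le> 1 + mean n (\<lambda>i. norm (e i) ^ 4)"
proof -
  have "t \<le> 1 + t ^ 4" if "0 \<le> t" for t :: real
    using self_le_power[of t 4] zero_le_power[OF that, of 4] by (cases "1 \<le> t") (simp, linarith)
  then have "mean n (\<lambda>i. norm (e i)) \<le> mean n (\<lambda>i. 1 + norm (e i) ^ 4)"
    by (intro mean_mono) auto
  with assms show ?thesis
    unfolding mean_add by simp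
qed

text \<open>With \<open>\<Delta> = Qh\<inverse> - Q\<inverse>\<close> and \<open>y = f + Q e\<close>, the residual error is
  \<open>\<Delta> Q e + \<Delta> (f - fh) + Q\<inverse> (f - fh)\<close>. Each of the three terms is estimated by the
  Cauchy--Schwarz inequality so that one factor contains an estimation error. Expanding around
  \<open>Q\<inverse>\<close> avoids any appeal to the norms of \<open>Qh\<inverse>\<close>, which are not controlled directly.\<close>

lemma mean_residual_error_le:
  fixes Q Qh :: "nat \<Rightarrow> real^'n^'n" and y f fh e :: "nat \<Rightarrow> real^'n"
  defines "\<delta> \<equiv> \<lambda>i. mat_norm (matrix_inv (Qh i) - matrix_inv (Q i))"
    and "\<phi> \<equiv> \<lambda>i. norm (f i - fh i)"
  assumes inv: "\<And>i. i \<in> {1..n} \<Longrightarrow> invertible (Q i)"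
    and e: "\<And>i. i \<in> {1..n} \<Longrightarrow> e i = matrix_inv (Q i) *v (y i - f i)"
  shows "mean n (\<lambda>i. norm (matrix_inv (Qh i) *v (y i - fh i) - e i))
    \<le> sqrt (mean n (\<lambda>i. \<delta> i ^ 2)) * sqrt (mean n (\<lambda>i. mat_norm (Q i) ^ 4) + mean n (\<lambda>i. norm (e i) ^ 4))
      + sqrt (mean n (\<lambda>i. \<delta> i ^ 2)) * sqrt (mean n (\<lambda>i. \<phi> i ^ 2))
      + sqrt (mean n (\<lambda>i. mat_norm (matrix_inv (Q i)) ^ 2)) * sqrt (mean n (\<lambda>i. \<phi> i ^ 2))"
proof -
  have pw: "norm (matrix_inv (Qh i) *v (y i - fh i) - e i)
      \<le> \<delta> i * (mat_norm (Q i) * norm (e i)) + \<delta> i * \<phi> i + mat_norm (matrix_inv (Q i)) * \<phi> i"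
    if i: "i \<in> {1..n}" for i
  proof -
    define \<Delta> where "\<Delta> = matrix_inv (Qh i) - matrix_inv (Q i)"
    have y: "y i = f i + Q i *v e i"
      by (simp add: e[OF i] matrix_vector_matrix_inv[OF inv[OF i]])
    have e': "e i = matrix_inv (Q i) *v (Q i *v e i)"
      using e[OF i] y by simp
    have Qh: "matrix_inv (Qh i) = \<Delta> + matrix_inv (Q i)"
      by (simp add: \<Delta>_def)
    have yf: "y i - fh i = Q i *v e i + (f i - fh i)"
      using y by simp
    have "matrix_inv (Qh i) *v (y i - fh i)
        = \<Delta> *v (Q i *v e i) + \<Delta> *v (f i - fh i) + matrix_inv (Q i) *v (f i - fh i) + matrix_inv (Q i) *v (Q i *v e i)"
      unfolding Qh yf by (simp only: matrix_vector_mult_add_rdistrib matrix_vector_right_distrib add_ac)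
    then have eq: "matrix_inv (Qh i) *v (y i - fh i) - e i
        = \<Delta> *v (Q i *v e i) + \<Delta> *v (f i - fh i) + matrix_inv (Q i) *v (f i - fh i)"
      using e' by simp
    have "norm (\<Delta> *v (Q i *v e i)) \<le> \<delta> i * (mat_norm (Q i) * norm (e i))"
      unfolding \<delta>_def \<Delta>_def
      by (rule order_trans[OF norm_matrix_vector_le]) (simp add: mult_left_mono norm_matrix_vector_le)
    moreover have "norm (\<Delta> *v (f i - fh i)) \<le> \<delta> i * \<phi> i"
      unfolding \<delta>_def \<phi>_def \<Delta>_def by (rule norm_matrix_vector_le)
    moreover have "norm (matrix_inv (Q i) *v (f i - fh i)) \<le> mat_norm (matrix_inv (Q i)) * \<phi> i"
      unfolding \<phi>_def by (rule norm_matrix_vector_le)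
    ultimately show ?thesis
      unfolding eq by (intro order_trans[OF norm_triangle_ineq] add_mono) auto
  qed
  have "(a * b)\<^sup>2 \<le> a ^ 4 + b ^ 4" for a b :: real
  proof -
    have "2 * (a * b)\<^sup>2 \<le> a ^ 4 + b ^ 4"
      using sum_squares_bound[of "a\<^sup>2" "b\<^sup>2"] by (simp add: power_mult_distrib)
    then show ?thesis
      using zero_le_power2[of "a * b"] by linarith
  qed
  then have Qe: "mean n (\<lambda>i. (mat_norm (Q i) * norm (e i))\<^sup>2)
      \<le> mean n (\<lambda>i. mat_norm (Q i) ^ 4) + mean n (\<lambda>i. norm (e i) ^ 4)"
    unfolding mean_add[symmetric] by (intro mean_mono) auto
  have "mean n (\<lambda>i. norm (matrix_inv (Qh i) *v (y i - fh i) - e i))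
      \<le> mean n (\<lambda>i. \<delta> i * (mat_norm (Q i) * norm (e i))) + mean n (\<lambda>i. \<delta> i * \<phi> i)
        + mean n (\<lambda>i. mat_norm (matrix_inv (Q i)) * \<phi> i)"
    unfolding mean_add[symmetric] by (intro mean_mono pw)
  also have "mean n (\<lambda>i. \<delta> i * (mat_norm (Q i) * norm (e i)))
      \<le> sqrt (mean n (\<lambda>i. \<delta> i ^ 2)) * sqrt (mean n (\<lambda>i. mat_norm (Q i) ^ 4) + mean n (\<lambda>i. norm (e i) ^ 4))"
    using Cauchy_Schwarz_mean by (rule order_trans) (intro mult_left_mono real_sqrt_le_mono Qe real_sqrt_ge_zero mean_nonneg, simp)
  finally show ?thesis
    using Cauchy_Schwarz_mean[of n \<delta> \<phi>] Cauchy_Schwarz_mean[of n "\<lambda>i. mat_norm (matrix_inv (Q i))" \<phi>]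
    by linarith
qed

text \<open>The unprojected scenarios differ by \<open>(ah - a) + (Ah - A) e + (Ah - A) (r - e) + A (r - e)\<close>.
  Since \<open>a + A e\<close> lies in \<open>Y\<close>, it is its own projection, and projecting does not increase this
  distance. Writing \<open>r = e + (r - e)\<close> reduces the dependence on the data to two means.\<close>

lemma mean_projected_cost_diff_le:
  fixes A Ah :: "real^'n^'m" and e r :: "nat \<Rightarrow> real^'n" and a ah :: "real^'m"
  assumes Y: "closed Y" "convex Y"
    and lip: "\<And>y y'. y \<in> Y \<Longrightarrow> y' \<in> Y \<Longrightarrow> \<bar>h y' - h y\<bar> \<le> \<Lambda> * norm (y' - y)" and "0 \<le> \<Lambda>"
    and mem: "\<And>i. i \<in> {1..n} \<Longrightarrow> a + A *v e i \<in> Y" and n: "1 \<le> n"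
  shows "\<bar>mean n (\<lambda>i. h (closest_point Y (ah + Ah *v r i))) - mean n (\<lambda>i. h (a + A *v e i))\<bar>
    \<le> \<Lambda> * (norm (ah - a) + mat_norm (Ah - A) * (mean n (\<lambda>i. norm (e i)) + mean n (\<lambda>i. norm (r i - e i)))
        + mat_norm A * mean n (\<lambda>i. norm (r i - e i)))"
proof -
  have ne: "Y \<noteq> {}" using mem[of 1] n by auto
  have pw: "\<bar>h (closest_point Y (ah + Ah *v r i)) - h (a + A *v e i)\<bar>
      \<le> \<Lambda> * (norm (ah - a) + (mat_norm (Ah - A) * norm (e i) + mat_norm (Ah - A) * norm (r i - e i))
          + mat_norm A * norm (r i - e i))" (is "_ \<le> \<Lambda> * ?b") if i: "i \<in> {1..n}" for i
  proof -
    let ?p = "ah + Ah *v r i" and ?q = "a + A *v e i"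
    have "\<bar>h (closest_point Y ?p) - h ?q\<bar> \<le> \<Lambda> * norm (closest_point Y ?p - ?q)"
      by (intro lip mem i closest_point_in_set Y ne)
    also have "norm (closest_point Y ?p - ?q) \<le> norm (?p - ?q)"
      using closest_point_lipschitz[OF Y(2,1) ne, of ?p ?q] mem[OF i]
      by (simp add: dist_norm closest_point_self)
    finally have le: "\<bar>h (closest_point Y ?p) - h ?q\<bar> \<le> \<Lambda> * norm (?p - ?q)"
      using \<open>0 \<le> \<Lambda>\<close> by (simp add: mult_left_mono)
    have "Ah *v r i = ((Ah - A) + A) *v (e i + (r i - e i))"
      by simp
    also have "\<dots> = (Ah - A) *v e i + (Ah - A) *v (r i - e i) + A *v (r i - e i) + A *v e i"
      by (simp only: matrix_vector_mult_add_rdistrib matrix_vector_right_distrib add_ac)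
    finally have "?p - ?q = (ah - a) + ((Ah - A) *v e i + (Ah - A) *v (r i - e i)) + A *v (r i - e i)"
      by simp
    also have "norm \<dots> \<le> ?b"
      by (intro norm_triangle_le add_mono norm_matrix_vector_le order_refl)
    finally show ?thesis
      using le \<open>0 \<le> \<Lambda>\<close> by (meson mult_left_mono order_trans)
  qed
  have "\<bar>mean n (\<lambda>i. h (closest_point Y (ah + Ah *v r i))) - mean n (\<lambda>i. h (a + A *v e i))\<bar>
      = (1 / real n) * \<bar>\<Sum>i=1..n. h (closest_point Y (ah + Ah *v r i)) - h (a + A *v e i)\<bar>"
    by (simp add: sum_subtractf abs_mult right_diff_distrib[symmetric] diff_divide_distrib[symmetric])
  also have "\<dots> \<le> mean n (\<lambda>i. \<bar>h (closest_point Y (ah + Ah *v r i)) - h (a + A *v e i)\<bar>)"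
    by (intro mult_left_mono sum_abs) auto
  also have "\<dots> \<le> mean n (\<lambda>i. \<Lambda> * (norm (ah - a) + (mat_norm (Ah - A) * norm (e i) + mat_norm (Ah - A) * norm (r i - e i))
          + mat_norm A * norm (r i - e i)))"
    by (intro mean_mono pw)
  also have "\<dots> = \<Lambda> * (norm (ah - a) + mat_norm (Ah - A) * (mean n (\<lambda>i. norm (e i)) + mean n (\<lambda>i. norm (r i - e i)))
        + mat_norm A * mean n (\<lambda>i. norm (r i - e i)))"
    unfolding mean_cmult mean_add using n by (simp add: distrib_left)
  finally show ?thesis .
qed

text \<open>A minimiser of \<open>h\<close> together with the uniform closeness bounds \<open>k\<close> from below; without a
  lower bound, its real-valued infimum would be an arbitrary value.\<close>

lemma optimal_value_perturbation:
  fixes h k :: "'a \<Rightarrow> real"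
  assumes opt: "is_arg_min h (\<lambda>z. z \<in> Z) z0"
    and close: "\<And>z. z \<in> Z \<Longrightarrow> \<bar>h z - k z\<bar> \<le> u"
  shows "\<bar>(INF z\<in>Z. h z) - (INF z\<in>Z. k z)\<bar> \<le> u" "\<bar>k z0 - (INF z\<in>Z. k z)\<bar> \<le> 2 * u"
proof -
  have z0: "z0 \<in> Z" and min: "\<And>z. z \<in> Z \<Longrightarrow> h z0 \<le> h z"
    using opt by (auto simp: is_arg_min_linorder)
  have low: "h z0 - u \<le> k z" if "z \<in> Z" for z
    using close[OF that] min[OF that] by linarith
  have bdd: "bdd_below (k ` Z)"
    using low by (intro bdd_belowI2)
  have h: "(INF z\<in>Z. h z) = h z0"
    using z0 min by (intro cInf_eq_minimum) auto
  have "h z0 - u \<le> (INF z\<in>Z. k z)"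
    using z0 low by (intro cINF_greatest) auto
  moreover have "(INF z\<in>Z. k z) \<le> k z0"
    using bdd z0 by (rule cINF_lower)
  moreover have "\<bar>h z0 - k z0\<bar> \<le> u" by (rule close[OF z0])
  ultimately show "\<bar>(INF z\<in>Z. h z) - (INF z\<in>Z. k z)\<bar> \<le> u" "\<bar>k z0 - (INF z\<in>Z. k z)\<bar> \<le> 2 * u"
    unfolding h by linarith+
qed

section \<open>Consistency of the empirical residuals approximation\<close>

theorem theorem6:
  fixes S :: "'s measure" and M :: "'w measure"
    and X :: "'s \<Rightarrow> real^'dx" and Y eps :: "'s \<Rightarrow> real^'dy"
    and PX :: "(real^'dx) measure" and Peps :: "(real^'dy) measure"
    and \<X> :: "(real^'dx) set" and \<Y> :: "(real^'dy) set" and \<Z> :: "(real^'dz) set"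
    and c :: "real^'dz \<Rightarrow> real^'dy \<Rightarrow> real"
    and fstar :: "real^'dx \<Rightarrow> real^'dy" and Qstar :: "real^'dx \<Rightarrow> real^'dy^'dy"
    and g :: "real^'dz \<Rightarrow> real^'dx \<Rightarrow> real" and vstar :: "real^'dx \<Rightarrow> real"
    and xs :: "nat \<Rightarrow> 'w \<Rightarrow> real^'dx" and ys err :: "nat \<Rightarrow> 'w \<Rightarrow> real^'dy"
    and D :: "nat \<Rightarrow> 'w \<Rightarrow> nat \<Rightarrow> (real^'dy) \<times> (real^'dx)"
    and gn :: "nat \<Rightarrow> 'w \<Rightarrow> real^'dz \<Rightarrow> real^'dx \<Rightarrow> real"
    and Fest :: "nat \<Rightarrow> (nat \<Rightarrow> (real^'dy) \<times> (real^'dx)) \<Rightarrow> real^'dx \<Rightarrow> real^'dy"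
    and Qest :: "nat \<Rightarrow> (nat \<Rightarrow> (real^'dy) \<times> (real^'dx)) \<Rightarrow> real^'dx \<Rightarrow> real^'dy^'dy"
    and fhat :: "nat \<Rightarrow> 'w \<Rightarrow> real^'dx \<Rightarrow> real^'dy"
    and Qhat :: "nat \<Rightarrow> 'w \<Rightarrow> real^'dx \<Rightarrow> real^'dy^'dy"
    and res :: "nat \<Rightarrow> nat \<Rightarrow> 'w \<Rightarrow> real^'dy"
    and ghat :: "nat \<Rightarrow> 'w \<Rightarrow> real^'dz \<Rightarrow> real^'dx \<Rightarrow> real"
    and vhat :: "nat \<Rightarrow> 'w \<Rightarrow> real^'dx \<Rightarrow> real"
    and zhat :: "nat \<Rightarrow> 'w \<Rightarrow> real^'dx \<Rightarrow> real^'dz"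
    and L :: "real^'dz \<Rightarrow> real" and q :: ennreal
  \<comment> \<open>population model\<close>
  assumes S: "prob_space S"
    and XYeps: "X \<in> borel_measurable S" "Y \<in> borel_measurable S" "eps \<in> borel_measurable S"
    and PX: "PX = law_on_support S X" and Peps: "Peps = distr S borel eps"
    and \<X>: "\<X> = msupport (distr S borel X)"
    and \<Y>: "\<Y> = msupport (distr S borel Y)" "\<Y> \<noteq> {}" "convex \<Y>"
    and \<Z>: "\<Z> \<noteq> {}" "compact \<Z>"
    and star_meas: "fstar \<in> borel_measurable PX" "Qstar \<in> borel_measurable PX"
    and model: "AE s in S. Y s = fstar (X s) + Qstar (X s) *v eps s"
    and cond_mean: "is_cond_mean S Y X fstar"
    and Qstar_pd: "\<And>x. x \<in> \<X> \<Longrightarrow> pos_def (Qstar x)"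
    and eps_mean: "integrable S eps" "integral\<^sup>L S eps = 0"
    and eps_indep: "indep_rv S eps X"
  \<comment> \<open>true problem; \<open>c\<close> is a total function, measurably extended from \<open>\<Z> \<times> \<Y>\<close>\<close>
    and c_meas: "(\<lambda>(z, y). c z y) \<in> borel_measurable (restrict_space borel \<Z> \<Otimes>\<^sub>M borel)"
    and c_int: "\<And>z. z \<in> \<Z> \<Longrightarrow> AE x in PX. integrable Peps (\<lambda>e. c z (fstar x + Qstar x *v e))"
    and g: "\<And>z x. g z x = (\<integral>e. c z (fstar x + Qstar x *v e) \<partial>Peps)"
    and g_lsc: "AE x in PX. lsc_on \<Z> (\<lambda>z. g z x)"
    and vstar: "\<And>x. vstar x = (INF z\<in>\<Z>. g z x)"
    and vstar_meas: "vstar \<in> borel_measurable PX"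
  \<comment> \<open>data and full-information SAA\<close>
    and M: "prob_space M"
    and data_meas: "\<And>i. i \<ge> 1 \<Longrightarrow> xs i \<in> measurable M (restrict_space borel \<X>)"
      "\<And>i. i \<ge> 1 \<Longrightarrow> ys i \<in> borel_measurable M"
    and D: "\<And>n \<omega>. D n \<omega> = (\<lambda>i\<in>{1..n}. (ys i \<omega>, xs i \<omega>))"
    and err: "\<And>i \<omega>. err i \<omega> = matrix_inv (Qstar (xs i \<omega>)) *v (ys i \<omega> - fstar (xs i \<omega>))"
    and err_supp: "\<And>i. i \<ge> 1 \<Longrightarrow> AE x in PX. AE \<omega> in M. fstar x + Qstar x *v err i \<omega> \<in> \<Y>"
    and gn: "\<And>n \<omega> z x. gn n \<omega> z x = (1 / real n) * (\<Sum>i=1..n. c z (fstar x + Qstar x *v err i \<omega>))"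
    and gn_meas: "\<And>n. n \<ge> 1 \<Longrightarrow>
      (\<lambda>(\<omega>, x). SUP z\<in>\<Z>. ennreal \<bar>gn n \<omega> z x - g z x\<bar>) \<in> borel_measurable (M \<Otimes>\<^sub>M PX)"
  \<comment> \<open>regression estimates and ER-SAA\<close>
    and est_meas: "\<And>n. n \<ge> 1 \<Longrightarrow> (\<lambda>(d, x). Fest n d x) \<in> borel_measurable
        (Pi\<^sub>M {1..n} (\<lambda>_. borel \<Otimes>\<^sub>M restrict_space borel \<X>) \<Otimes>\<^sub>M restrict_space borel \<X>)"
      "\<And>n. n \<ge> 1 \<Longrightarrow> (\<lambda>(d, x). Qest n d x) \<in> borel_measurable
        (Pi\<^sub>M {1..n} (\<lambda>_. borel \<Otimes>\<^sub>M restrict_space borel \<X>) \<Otimes>\<^sub>M restrict_space borel \<X>)"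
    and fhat: "\<And>n \<omega>. fhat n \<omega> = Fest n (D n \<omega>)"
    and Qhat: "\<And>n \<omega>. Qhat n \<omega> = Qest n (D n \<omega>)"
    and Qhat_inv: "\<And>n \<omega> x. n \<ge> 1 \<Longrightarrow> \<omega> \<in> space M \<Longrightarrow> x \<in> \<X> \<Longrightarrow> invertible (Qhat n \<omega> x)"
    and res: "\<And>n i \<omega>. res n i \<omega> = matrix_inv (Qhat n \<omega> (xs i \<omega>)) *v (ys i \<omega> - fhat n \<omega> (xs i \<omega>))"
    and ghat: "\<And>n \<omega> z x. ghat n \<omega> z x =
      (1 / real n) * (\<Sum>i=1..n. c z (closest_point \<Y> (fhat n \<omega> x + Qhat n \<omega> x *v res n i \<omega>)))"
    and vhat: "\<And>n \<omega> x. vhat n \<omega> x = (INF z\<in>\<Z>. ghat n \<omega> z x)"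
    and vhat_meas: "\<And>n. n \<ge> 1 \<Longrightarrow> (\<lambda>(\<omega>, x). vhat n \<omega> x) \<in> borel_measurable (M \<Otimes>\<^sub>M PX)"
    and zhat_meas: "\<And>n. n \<ge> 1 \<Longrightarrow>
      (\<lambda>(\<omega>, x). zhat n \<omega> x) \<in> measurable (M \<Otimes>\<^sub>M PX) (restrict_space borel \<Z>)"
    and zhat_opt: "\<And>n. n \<ge> 1 \<Longrightarrow> AE \<omega> in M. AE x in PX.
      is_arg_min (\<lambda>z. ghat n \<omega> z x) (\<lambda>z. z \<in> \<Z>) (zhat n \<omega> x)"
  \<comment> \<open>hypotheses of the theorem\<close>
    and q: "1 \<le> q"
    and Qstar_Lq: "Lq_norm q PX (\<lambda>x. ennreal (mat_norm (Qstar x))) < \<infinity>"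
    and A1: "\<And>z y y'. z \<in> \<Z> \<Longrightarrow> y \<in> \<Y> \<Longrightarrow> y' \<in> \<Y> \<Longrightarrow> \<bar>c z y' - c z y\<bar> \<le> L z * norm (y' - y)"
      "bdd_above (L ` \<Z>)"
    and A2: "conv_prob_zero M
      (\<lambda>n \<omega>. Lq_norm q PX (\<lambda>x. SUP z\<in>\<Z>. ennreal \<bar>gn n \<omega> z x - g z x\<bar>))"
    and A3: "integrable PX (\<lambda>x. mat_norm (Qstar x) ^ 4)"
      "conv_prob M (\<lambda>n \<omega>. (1 / real n) * (\<Sum>i=1..n. mat_norm (Qstar (xs i \<omega>)) ^ 4))
         (\<integral>x. mat_norm (Qstar x) ^ 4 \<partial>PX)"
      "integrable PX (\<lambda>x. mat_norm (matrix_inv (Qstar x)) ^ 2)"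
      "conv_prob M (\<lambda>n \<omega>. (1 / real n) * (\<Sum>i=1..n. mat_norm (matrix_inv (Qstar (xs i \<omega>))) ^ 2))
         (\<integral>x. mat_norm (matrix_inv (Qstar x)) ^ 2 \<partial>PX)"
    and A4: "integrable Peps (\<lambda>e. norm e ^ 4)"
      "conv_prob M (\<lambda>n \<omega>. (1 / real n) * (\<Sum>i=1..n. norm (err i \<omega>) ^ 4)) (\<integral>e. norm e ^ 4 \<partial>Peps)"
    and A5a: "conv_prob_zero M (\<lambda>n \<omega>. Lq_norm q PX (\<lambda>x. ennreal (norm (fhat n \<omega> x - fstar x))))"
    and A5b: "conv_prob M
      (\<lambda>n \<omega>. (1 / real n) * (\<Sum>i=1..n. norm (fstar (xs i \<omega>) - fhat n \<omega> (xs i \<omega>)) ^ 2)) 0"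
    and A5c: "conv_prob_zero M (\<lambda>n \<omega>. Lq_norm q PX (\<lambda>x. ennreal (mat_norm (Qhat n \<omega> x - Qstar x))))"
    and A5d: "conv_prob M
      (\<lambda>n \<omega>. (1 / real n) * (\<Sum>i=1..n.
         mat_norm (matrix_inv (Qhat n \<omega> (xs i \<omega>)) - matrix_inv (Qstar (xs i \<omega>))) ^ 2)) 0"
  shows "conv_prob_zero M (\<lambda>n \<omega>. Lq_norm q PX (\<lambda>x. ennreal \<bar>vhat n \<omega> x - vstar x\<bar>))
       \<and> conv_prob_zero M (\<lambda>n \<omega>. Lq_norm q PX (\<lambda>x. ennreal \<bar>g (zhat n \<omega> x) x - vstar x\<bar>))"
proof -
  interpret S: prob_space S by (rule S)
  interpret M: prob_space M by (rule M)

  define \<mu> where "\<mu> = distr S borel X"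
  interpret \<mu>: prob_space \<mu>
    unfolding \<mu>_def using XYeps(1) by (rule S.prob_space_distr)
  have \<X>_closed: "closed \<X>" and \<Y>_closed: "closed \<Y>"
    unfolding \<X> \<Y>(1) by (rule closed_msupport)+
  have PX_eq: "PX = restrict_space \<mu> \<X>"
    by (simp add: PX law_on_support_def \<mu>_def \<X>)
  have sets_PX: "sets PX = sets (restrict_space borel \<X>)"
    unfolding PX_eq by (rule sets_restrict_space_cong) (simp add: \<mu>_def)
  have space_PX: "space PX = \<X>"
    by (simp add: PX_eq \<mu>_def space_restrict_space)
  have "\<X> \<in> sets \<mu>"
    using \<X>_closed by (simp add: \<mu>_def)
  then interpret PX: finite_measure PX
    unfolding PX_eq by (intro finite_measure_restrict_space \<mu>.finite_measure_axioms)
  interpret Peps: prob_space Peps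
    unfolding Peps using XYeps(3) by (rule S.prob_space_distr)
  have sets_Peps [measurable_cong]: "sets Peps = sets borel"
    by (simp add: Peps)
  interpret PXM: pair_sigma_finite PX M ..
  note star_meas [measurable]

  have xs_in: "xs i \<omega> \<in> \<X>" if "1 \<le> i" "\<omega> \<in> space M" for i \<omega>
    using measurable_space[OF data_meas(1)[OF that(1)] that(2)] by (simp add: space_restrict_space)
  have xs_PX [measurable]: "xs i \<in> measurable M PX" if "1 \<le> i" for i
    using data_meas(1)[OF that] by (simp cong: measurable_cong_sets add: sets_PX)
  have Qstar_inv: "invertible (Qstar x)" if "x \<in> \<X>" for x
    using Qstar_pd[OF that] by (rule invertible_pos_def)

  have err_meas: "err i \<in> borel_measurable M" if i: "1 \<le> i" for i
  proof -
    note [measurable] = data_meas(2)[OF i] xs_PX[OF i]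
    have "(\<lambda>\<omega>. matrix_inv (Qstar (xs i \<omega>)) *v (ys i \<omega> - fstar (xs i \<omega>))) \<in> borel_measurable M"
      by (intro borel_measurable_matrix_inv_mult) (auto intro!: Qstar_inv xs_in i)
    then show ?thesis by (simp add: err[abs_def])
  qed

  \<comment> \<open>The exceptional set of covariates must be chosen after the data. Exchanging the two quantifiers
    is Fubini's theorem, for which the errors have to be measurable and \<open>\<Y>\<close> closed.\<close>
  have supp: "AE \<omega> in M. AE x in PX. \<forall>i\<ge>1. fstar x + Qstar x *v err i \<omega> \<in> \<Y>"
  proof -
    have "AE \<omega> in M. AE x in PX. fstar x + Qstar x *v err i \<omega> \<in> \<Y>" if i: "1 \<le> i" for i
    proof -
      note [measurable] = err_meas[OF i] borel_closed[OF \<Y>_closed]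
      have "{p \<in> space (PX \<Otimes>\<^sub>M M). fstar (fst p) + Qstar (fst p) *v err i (snd p) \<in> \<Y>} \<in> sets (PX \<Otimes>\<^sub>M M)"
        by measurable
      from PXM.AE_commute[OF this] err_supp[OF i] show ?thesis by simp
    qed
    then have "AE \<omega> in M. \<forall>i. 1 \<le> i \<longrightarrow> (AE x in PX. fstar x + Qstar x *v err i \<omega> \<in> \<Y>)"
      by (subst AE_all_countable) auto
    then show ?thesis
    proof eventually_elim
      case (elim \<omega>)
      show ?case
        unfolding AE_all_countable using elim by auto
    qed
  qed

  have D_space: "D n \<omega> \<in> space (Pi\<^sub>M {1..n} (\<lambda>_. borel \<Otimes>\<^sub>M restrict_space borel \<X>))"
    if "\<omega> \<in> space M" for n \<omega>
    using xs_in[OF _ that] by (auto simp: D space_PiM space_pair_measure space_restrict_space)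
  have fhat_meas: "fhat n \<omega> \<in> borel_measurable PX" and Qhat_meas: "Qhat n \<omega> \<in> borel_measurable PX"
    if n: "1 \<le> n" and \<omega>: "\<omega> \<in> space M" for n \<omega>
    using measurable_compose[OF measurable_Pair1'[OF D_space[OF \<omega>]] est_meas(1)[OF n]]
      measurable_compose[OF measurable_Pair1'[OF D_space[OF \<omega>]] est_meas(2)[OF n]]
    by (simp_all add: fhat Qhat cong: measurable_cong_sets[OF sets_PX refl])

  \<comment> \<open>If \<open>\<Y>\<close> is a single point, the Lipschitz constants may be negative.\<close>
  define \<Lambda> where "\<Lambda> = max 0 (SUP z\<in>\<Z>. L z)"
  have \<Lambda>: "0 \<le> \<Lambda>" by (simp add: \<Lambda>_def)
  have lip: "\<bar>c z y' - c z y\<bar> \<le> \<Lambda> * norm (y' - y)" if "z \<in> \<Z>" "y \<in> \<Y>" "y' \<in> \<Y>" for z y y'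
  proof -
    have "L z \<le> \<Lambda>"
      using cSUP_upper[OF that(1) A1(2)] by (simp add: \<Lambda>_def)
    with A1(1)[OF that] show ?thesis
      by (meson mult_right_mono norm_ge_zero order_trans)
  qed

  define E where "E n \<omega> = mean n (\<lambda>i. norm (err i \<omega>))" for n \<omega>
  define R where "R n \<omega> = mean n (\<lambda>i. norm (res n i \<omega> - err i \<omega>))" for n \<omega>
  have ER_nonneg: "0 \<le> E n \<omega>" "0 \<le> R n \<omega>" for n \<omega>
    unfolding E_def R_def by (intro mean_nonneg; simp)+
  define G where "G n \<omega> x = (SUP z\<in>\<Z>. ennreal \<bar>gn n \<omega> z x - g z x\<bar>)" for n \<omega> x
  \<comment> \<open>This is twice the bound on the uniform error of the approximate objective; the factor serves
    the second claim, where the error of the objective enters at two points.\<close>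
  define W where "W n \<omega> x = 2 * G n \<omega> x
    + (ennreal (2 * \<Lambda>) * ennreal (norm (fhat n \<omega> x - fstar x))
    + (ennreal (2 * \<Lambda> * (E n \<omega> + R n \<omega>)) * ennreal (mat_norm (Qhat n \<omega> x - Qstar x))
    + ennreal (2 * \<Lambda> * R n \<omega>) * ennreal (mat_norm (Qstar x))))" for n \<omega> x

  have dominated: "AE \<omega> in M. AE x in PX. ennreal \<bar>vhat n \<omega> x - vstar x\<bar> \<le> W n \<omega> x \<and>
      ennreal \<bar>g (zhat n \<omega> x) x - vstar x\<bar> \<le> W n \<omega> x" if n: "1 \<le> n" for n
    using supp zhat_opt[OF n]
  proof eventually_elim
    case (elim \<omega>)
    from elim show ?case
    proof eventually_elim
      case (elim x)
      show ?case
      proof (cases "G n \<omega> x = \<top>")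
        \<comment> \<open>At a given sample size, the supremum may well be infinite.\<close>
        case True
        then show ?thesis by (simp add: W_def ennreal_mult_top)
      next
        case False
        then obtain s where s: "0 \<le> s" "G n \<omega> x = ennreal s"
          by (cases "G n \<omega> x") auto
        define b where "b = norm (fhat n \<omega> x - fstar x)
          + mat_norm (Qhat n \<omega> x - Qstar x) * (E n \<omega> + R n \<omega>) + mat_norm (Qstar x) * R n \<omega>"
        have b: "0 \<le> b"
          unfolding b_def using ER_nonneg by simp
        have close: "\<bar>ghat n \<omega> z x - g z x\<bar> \<le> s + \<Lambda> * b" if z: "z \<in> \<Z>" for z
        proof -
          have "ennreal \<bar>gn n \<omega> z x - g z x\<bar> \<le> ennreal s"
            unfolding s(2)[symmetric] G_def using z by (rule SUP_upper)
          then have "\<bar>gn n \<omega> z x - g z x\<bar> \<le> s"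
            using s(1) by simp
          moreover have "\<bar>ghat n \<omega> z x - gn n \<omega> z x\<bar> \<le> \<Lambda> * b"
            unfolding ghat gn b_def E_def R_def
            by (rule mean_projected_cost_diff_le[OF \<Y>_closed \<Y>(3)])
               (use lip[OF z] \<Lambda> elim(1) n in auto)
          ultimately show ?thesis by linarith
        qed
        have W: "W n \<omega> x = ennreal (2 * (s + \<Lambda> * b))"
          unfolding W_def s(2) b_def using s(1) \<Lambda> ER_nonneg
          by (simp add: ennreal_mult[symmetric] ennreal_plus[symmetric] algebra_simps
              del: ennreal_plus flip: ennreal_numeral)
        have "\<bar>(INF z\<in>\<Z>. ghat n \<omega> z x) - (INF z\<in>\<Z>. g z x)\<bar> \<le> s + \<Lambda> * b"
          using elim(2) close by (rule optimal_value_perturbation(1))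
        also have "\<dots> \<le> 2 * (s + \<Lambda> * b)"
          using s(1) mult_nonneg_nonneg[OF \<Lambda> b] by simp
        finally have "\<bar>vhat n \<omega> x - vstar x\<bar> \<le> 2 * (s + \<Lambda> * b)"
          unfolding vhat vstar .
        moreover have "\<bar>g (zhat n \<omega> x) x - vstar x\<bar> \<le> 2 * (s + \<Lambda> * b)"
          unfolding vstar using elim(2) close by (rule optimal_value_perturbation(2))
        ultimately show ?thesis
          unfolding W by (intro conjI ennreal_leI)
      qed
    qed
  qed

  define d2 where "d2 n \<omega> = mean n (\<lambda>i.
      mat_norm (matrix_inv (Qhat n \<omega> (xs i \<omega>)) - matrix_inv (Qstar (xs i \<omega>))) ^ 2)" for n \<omega>
  define f2 where "f2 n \<omega> = mean n (\<lambda>i. norm (fstar (xs i \<omega>) - fhat n \<omega> (xs i \<omega>)) ^ 2)" for n \<omega>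
  define Q4 where "Q4 n \<omega> = mean n (\<lambda>i. mat_norm (Qstar (xs i \<omega>)) ^ 4)" for n \<omega>
  define I2 where "I2 n \<omega> = mean n (\<lambda>i. mat_norm (matrix_inv (Qstar (xs i \<omega>))) ^ 2)" for n \<omega>
  define e4 where "e4 n \<omega> = mean n (\<lambda>i. norm (err i \<omega>) ^ 4)" for n \<omega>
  define B where "B n \<omega> = sqrt (d2 n \<omega>) * sqrt (Q4 n \<omega> + e4 n \<omega>) + sqrt (d2 n \<omega>) * sqrt (f2 n \<omega>)
    + sqrt (I2 n \<omega>) * sqrt (f2 n \<omega>)" for n \<omega>
  have R_le: "R n \<omega> \<le> B n \<omega>" if "\<omega> \<in> space M" for n \<omega>
    unfolding R_def B_def d2_def f2_def Q4_def I2_def e4_def res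
    by (rule mean_residual_error_le) (auto simp: err intro!: Qstar_inv xs_in that)
  have E_le: "E n \<omega> \<le> 1 + e4 n \<omega>" if "1 \<le> n" for n \<omega>
    unfolding E_def e4_def by (rule mean_norm_le_mean_power4[OF that])

  let ?F = "in_prob M"
  have lim4: "((\<lambda>p. e4 (fst p) (snd p)) \<longlongrightarrow> (\<integral>e. norm e ^ 4 \<partial>Peps)) ?F"
    using M.conv_prob_tendsto[OF A4(2)] by (simp add: e4_def case_prod_unfold)
  have limB: "((\<lambda>p. B (fst p) (snd p)) \<longlongrightarrow> 0) ?F"
  proof -
    have "((\<lambda>p. d2 (fst p) (snd p)) \<longlongrightarrow> 0) ?F" "((\<lambda>p. f2 (fst p) (snd p)) \<longlongrightarrow> 0) ?F"
      "((\<lambda>p. Q4 (fst p) (snd p)) \<longlongrightarrow> (\<integral>x. mat_norm (Qstar x) ^ 4 \<partial>PX)) ?F"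
      "((\<lambda>p. I2 (fst p) (snd p)) \<longlongrightarrow> (\<integral>x. mat_norm (matrix_inv (Qstar x)) ^ 2 \<partial>PX)) ?F"
      using M.conv_prob_tendsto[OF A5d] M.conv_prob_tendsto[OF A5b]
        M.conv_prob_tendsto[OF A3(2)] M.conv_prob_tendsto[OF A3(4)]
      by (simp_all add: d2_def f2_def Q4_def I2_def case_prod_unfold)
    from tendsto_add[OF tendsto_add[OF
        tendsto_mult[OF tendsto_real_sqrt[OF this(1)] tendsto_real_sqrt[OF tendsto_add[OF this(3) lim4]]]
        tendsto_mult[OF tendsto_real_sqrt[OF this(1)] tendsto_real_sqrt[OF this(2)]]]
        tendsto_mult[OF tendsto_real_sqrt[OF this(4)] tendsto_real_sqrt[OF this(2)]]]
    show ?thesis by (simp add: B_def)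
  qed

  define C where "C = Lq_norm q PX (\<lambda>x. ennreal (mat_norm (Qstar x)))"
  have C: "C \<noteq> \<top>" using Qstar_Lq by (simp add: C_def)
  \<comment> \<open>The norm of \<open>W\<close> is at most \<open>H\<close>, which arises by replacing \<open>E\<close> and \<open>R\<close> by bounds that converge
    along the filter.\<close>
  define H where "H n \<omega> = 64 * (2 * Lq_norm q PX (G n \<omega>)
    + ennreal (2 * \<Lambda>) * Lq_norm q PX (\<lambda>x. ennreal (norm (fhat n \<omega> x - fstar x)))
    + ennreal (2 * \<Lambda> * (1 + e4 n \<omega> + B n \<omega>)) * Lq_norm q PX (\<lambda>x. ennreal (mat_norm (Qhat n \<omega> x - Qstar x)))
    + ennreal (2 * \<Lambda> * B n \<omega>) * C)" for n \<omega>
  have limH: "((\<lambda>p. H (fst p) (snd p)) \<longlongrightarrow> 0) ?F"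
  proof -
    let ?l = "\<integral>e. norm e ^ 4 \<partial>Peps"
    have "((\<lambda>p. H (fst p) (snd p)) \<longlongrightarrow> 64 * (2 * 0 + ennreal (2 * \<Lambda>) * 0
        + ennreal (2 * \<Lambda> * (1 + ?l + 0)) * 0 + ennreal (2 * \<Lambda> * 0) * C)) ?F"
      unfolding H_def
      using A2 A5a A5c unfolding M.conv_prob_zero_iff case_prod_unfold G_def[symmetric]
      by (intro tendsto_add tendsto_mult_ennreal tendsto_const tendsto_ennrealI tendsto_mult lim4 limB)
         (use C in auto)
    then show ?thesis by simp
  qed

  have norm_le_H: "AE \<omega> in M. Lq_norm q PX (\<lambda>x. ennreal (\<Phi> \<omega> x)) \<le> H n \<omega>"
    if n: "1 \<le> n"
      and \<Phi> [measurable]: "(\<lambda>(\<omega>, x). \<Phi> \<omega> x) \<in> borel_measurable (M \<Otimes>\<^sub>M PX)"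
      and le: "AE \<omega> in M. AE x in PX. ennreal (\<Phi> \<omega> x) \<le> W n \<omega> x" for n and \<Phi> :: "'w \<Rightarrow> _ \<Rightarrow> real"
    using le AE_space
  proof eventually_elim
    case (elim \<omega>)
    note [measurable] = fhat_meas[OF n elim(2)] Qhat_meas[OF n elim(2)]
    have G [measurable]: "G n \<omega> \<in> borel_measurable PX"
      using measurable_compose[OF measurable_Pair1'[OF elim(2)] gn_meas[OF n]] by (simp add: G_def[abs_def])
    have [measurable]: "\<Phi> \<omega> \<in> borel_measurable PX"
      using measurable_compose[OF measurable_Pair1'[OF elim(2)] \<Phi>] by simp
    have "Lq_norm q PX (\<lambda>x. ennreal (\<Phi> \<omega> x)) \<le> Lq_norm q PX (W n \<omega>)"
      using elim(1) by (intro Lq_norm_mono) auto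
    also have "\<dots> \<le> 64 * (2 * Lq_norm q PX (G n \<omega>)
        + ennreal (2 * \<Lambda>) * Lq_norm q PX (\<lambda>x. ennreal (norm (fhat n \<omega> x - fstar x)))
        + ennreal (2 * \<Lambda> * (E n \<omega> + R n \<omega>)) * Lq_norm q PX (\<lambda>x. ennreal (mat_norm (Qhat n \<omega> x - Qstar x)))
        + ennreal (2 * \<Lambda> * R n \<omega>) * C)"
      unfolding W_def[abs_def] C_def by (rule Lq_norm_combination4_le[OF _ _ _ _ q]) measurable
    also have "\<dots> \<le> H n \<omega>"
      unfolding H_def using R_le[OF elim(2), of n] E_le[OF n, of \<omega>] \<Lambda>
      by (intro mult_left_mono add_mono mult_right_mono ennreal_leI order_refl) auto
    finally show ?case .
  qed

  have conv: "conv_prob_zero M (\<lambda>n \<omega>. Lq_norm q PX (\<lambda>x. ennreal \<bar>\<Phi> n \<omega> x\<bar>))"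
    if \<Phi>: "\<And>n. 1 \<le> n \<Longrightarrow> (\<lambda>(\<omega>, x). \<Phi> n \<omega> x) \<in> borel_measurable (M \<Otimes>\<^sub>M PX)"
      and le: "\<And>n. 1 \<le> n \<Longrightarrow> AE \<omega> in M. AE x in PX. ennreal \<bar>\<Phi> n \<omega> x\<bar> \<le> W n \<omega> x"
    for \<Phi> :: "nat \<Rightarrow> 'w \<Rightarrow> _ \<Rightarrow> real"
    unfolding M.conv_prob_zero_iff
  proof (intro conjI allI impI)
    have abs: "(\<lambda>(\<omega>, x). \<bar>\<Phi> n \<omega> x\<bar>) \<in> borel_measurable (M \<Otimes>\<^sub>M PX)" if "1 \<le> n" for n
      using \<Phi>[OF that] unfolding case_prod_unfold by (rule borel_measurable_abs)
    show "(\<lambda>\<omega>. Lq_norm q PX (\<lambda>x. ennreal \<bar>\<Phi> n \<omega> x\<bar>)) \<in> borel_measurable M" if "1 \<le> n" for n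
      by (rule PX.borel_measurable_Lq_norm) (use abs[OF that] in \<open>simp add: case_prod_unfold\<close>)
    show "((\<lambda>(n, \<omega>). Lq_norm q PX (\<lambda>x. ennreal \<bar>\<Phi> n \<omega> x\<bar>)) \<longlongrightarrow> 0) ?F"
    proof (rule tendsto_sandwich[OF _ _ tendsto_const limH])
      show "\<forall>\<^sub>F p in ?F. (case p of (n, \<omega>) \<Rightarrow> Lq_norm q PX (\<lambda>x. ennreal \<bar>\<Phi> n \<omega> x\<bar>)) \<le> H (fst p) (snd p)"
        by (rule M.eventually_in_prob_AE) (use norm_le_H[OF _ abs le] in simp)
    qed simp
  qed

  have g_zhat_meas: "(\<lambda>(\<omega>, x). g (zhat n \<omega> x) x) \<in> borel_measurable (M \<Otimes>\<^sub>M PX)" if n: "1 \<le> n" for n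
  proof -
    have [measurable]: "(\<lambda>p. zhat n (fst p) (snd p)) \<in> measurable (M \<Otimes>\<^sub>M PX) (restrict_space borel \<Z>)"
      using zhat_meas[OF n] by (simp add: case_prod_unfold)
    have "(\<lambda>r. (zhat n (fst (fst r)) (snd (fst r)), fstar (snd (fst r)) + Qstar (snd (fst r)) *v snd r))
        \<in> measurable ((M \<Otimes>\<^sub>M PX) \<Otimes>\<^sub>M Peps) (restrict_space borel \<Z> \<Otimes>\<^sub>M borel)"
      by measurable
    from measurable_compose[OF this c_meas]
    have "(\<lambda>(p, e). c (zhat n (fst p) (snd p)) (fstar (snd p) + Qstar (snd p) *v e))
        \<in> borel_measurable ((M \<Otimes>\<^sub>M PX) \<Otimes>\<^sub>M Peps)"
      by (simp add: case_prod_unfold)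
    then show ?thesis
      unfolding g case_prod_unfold
      by (intro Peps.borel_measurable_lebesgue_integral) (simp add: case_prod_unfold)
  qed

  show ?thesis
  proof (intro conjI conv)
    fix n :: nat assume n: "1 \<le> n"
    have [measurable]: "(\<lambda>p. vhat n (fst p) (snd p)) \<in> borel_measurable (M \<Otimes>\<^sub>M PX)"
        "(\<lambda>p. g (zhat n (fst p) (snd p)) (snd p)) \<in> borel_measurable (M \<Otimes>\<^sub>M PX)"
        "vstar \<in> borel_measurable PX"
      using vhat_meas[OF n] g_zhat_meas[OF n] vstar_meas by (simp_all add: case_prod_unfold)
    show "(\<lambda>(\<omega>, x). vhat n \<omega> x - vstar x) \<in> borel_measurable (M \<Otimes>\<^sub>M PX)"
        "(\<lambda>(\<omega>, x). g (zhat n \<omega> x) x - vstar x) \<in> borel_measurable (M \<Otimes>\<^sub>M PX)"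
      unfolding case_prod_unfold by measurable
    show "AE \<omega> in M. AE x in PX. ennreal \<bar>vhat n \<omega> x - vstar x\<bar> \<le> W n \<omega> x"
        "AE \<omega> in M. AE x in PX. ennreal \<bar>g (zhat n \<omega> x) x - vstar x\<bar> \<le> W n \<omega> x"
      using dominated[OF n] by (auto elim!: eventually_mono)
  qed
qed

end
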